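(* Let $V$ be a vector space over a field, let $U$ be a subspace of $V$ with $U\neq V$, and let $L_{GL(U)}(V)=\{\alpha\in L(V):\alpha|_U\in GL(U)\}$. Let $\mathscr{L}^U,\mathscr{R}^U,\mathscr{H}^U,\mathscr{D}^U,\mathscr{J}^U$ denote Green's relations on the semigroup $L_{GL(U)}(V)$. Then for all $\alpha,\beta\in L_{GL(U)}(V)$ the following hold. (1) $(\alpha,\beta)\in\mathscr{L}^U$ if and only if $V\alpha=V\beta$. (2) $(\alpha,\beta)\in\mathscr{R}^U$ if and only if $\ker\alpha=\ker\beta$. (3) $(\alpha,\beta)\in\mathscr{H}^U$ if and only if $V\alpha=V\beta$ and $\ker\alpha=\ker\beta$. (4) $(\alpha,\beta)\in\mathscr{D}^U$ if and only if $\dim(V\alpha/U)=\dim(V\beta/U)$. (5) $\mathscr{D}^U=\mathscr{J}^U$.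
   Context: $L(V)$ is the semigroup of all linear maps $V\to V$ under composition; maps are written on the right and composed from left to right, so $v(\alpha\beta)=(v\alpha)\beta$, and $V\alpha$ is the range of $\alpha$. $GL(U)$ is the group of all bijective linear maps $U\to U$; $\alpha|_U\in GL(U)$ means that $\alpha$ restricts to a bijection of $U$ onto $U$ (so $U\subseteq V\alpha$ and $V\alpha/U$ makes sense). $V$ may be infinite-dimensional; dimensions are cardinals. $L_{GL(U)}(V)$ is a monoid with identity $1_V$. For a monoid $S$ and $a,b\in S$: $a\,\mathscr{L}\,b$ iff there are $u,v\in S$ with $ua=b$, $vb=a$ (i.e. $Sa=Sb$); $a\,\mathscr{R}\,b$ iff $aS=bS$; $\mathscr{H}=\mathscr{L}\cap\mathscr{R}$; $\mathscr{D}=\mathscr{L}\circ\mathscr{R}$ (the join of $\mathscr{L}$ and $\mathscr{R}$); $a\,\mathscr{J}\,b$ iff $SaS=SbS$. *)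

theory Defs
  imports "HOL-Algebra.Algebraic_Closure_Type"
begin

unbundle cardinal_syntax

section \<open>Green's relations of a monoid\<close>

text \<open>In the notation of \<^theory>\<open>HOL-Algebra.Coset\<close>, \<open>carrier S #>\<^bsub>S\<^esub> a\<close> is the left ideal \<open>Sa\<close>,
  \<open>a <#\<^bsub>S\<^esub> carrier S\<close> is the right ideal \<open>aS\<close>, and \<open>carrier S <#>\<^bsub>S\<^esub> (a <#\<^bsub>S\<^esub> carrier S)\<close> is \<open>SaS\<close>.\<close>

definition green_L :: "('a, 'm) monoid_scheme \<Rightarrow> 'a rel" where
  "green_L S = {(a, b). a \<in> carrier S \<and> b \<in> carrier S \<and>
     carrier S #>\<^bsub>S\<^esub> a = carrier S #>\<^bsub>S\<^esub> b}"

definition green_R :: "('a, 'm) monoid_scheme \<Rightarrow> 'a rel" where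
  "green_R S = {(a, b). a \<in> carrier S \<and> b \<in> carrier S \<and>
     a <#\<^bsub>S\<^esub> carrier S = b <#\<^bsub>S\<^esub> carrier S}"

definition green_H :: "('a, 'm) monoid_scheme \<Rightarrow> 'a rel" where
  "green_H S = green_L S \<inter> green_R S"

definition green_D :: "('a, 'm) monoid_scheme \<Rightarrow> 'a rel" where
  "green_D S = green_L S O green_R S"

definition green_J :: "('a, 'm) monoid_scheme \<Rightarrow> 'a rel" where
  "green_J S = {(a, b). a \<in> carrier S \<and> b \<in> carrier S \<and>
     carrier S <#>\<^bsub>S\<^esub> (a <#\<^bsub>S\<^esub> carrier S) = carrier S <#>\<^bsub>S\<^esub> (b <#\<^bsub>S\<^esub> carrier S)}"

lemma (in monoid) green_L_iff:
  "(a, b) \<in> green_L G \<longleftrightarrow> a \<in> carrier G \<and> b \<in> carrier G \<and>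
     (\<exists>u\<in>carrier G. \<exists>v\<in>carrier G. u \<otimes> a = b \<and> v \<otimes> b = a)"
proof -
  have sub: "carrier G #> x \<subseteq> carrier G #> y"
    if "w \<in> carrier G" "x = w \<otimes> y" "y \<in> carrier G" for w x y
    using that by (auto simp: r_coset_def m_assoc[symmetric])
  have mem: "\<exists>w\<in>carrier G. w \<otimes> y = x"
    if "carrier G #> x \<subseteq> carrier G #> y" "x \<in> carrier G" for x y
  proof -
    have "x \<in> carrier G #> x"
      unfolding r_coset_def using that(2) by (auto intro: bexI[of _ \<one>])
    then show ?thesis
      using that(1) by (auto simp: r_coset_def)
  qed
  show ?thesis
    unfolding green_L_def using sub mem by simp (metis order_refl subset_antisym)
qed


section \<open>The monoid of linear maps restricting to a bijection of a subspace\<close>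

text \<open>Maps act on the right, so the product of \<open>\<alpha>\<close> and \<open>\<beta>\<close> is \<open>\<alpha>\<close> followed by \<open>\<beta>\<close>.\<close>

definition L_GL :: "('k::field \<Rightarrow> 'v::ab_group_add \<Rightarrow> 'v) \<Rightarrow> 'v set \<Rightarrow> ('v \<Rightarrow> 'v) monoid" where
  "L_GL scale U =
     \<lparr>carrier = {\<alpha>. Vector_Spaces.linear scale scale \<alpha> \<and> bij_betw \<alpha> U U},
      monoid.mult = (\<lambda>\<alpha> \<beta>. \<beta> \<circ> \<alpha>),
      one = id\<rparr>"

lemma monoid_L_GL:
  assumes "vector_space scale"
  shows "monoid (L_GL scale U)"
proof -
  interpret vector_space scale by fact
  show ?thesis
    by (rule monoidI)
      (auto simp: L_GL_def comp_assoc linear_id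
        intro: Vector_Spaces.linear_compose bij_betw_trans)
qed


section \<open>Quotient spaces and dimensions as cardinals\<close>

text \<open>A subspace \<open>W\<close> as an algebraic structure of its own; the multiplicative part of the record
  plays no role.\<close>

definition subspace_module ::
  "('k::field \<Rightarrow> 'v::ab_group_add \<Rightarrow> 'v) \<Rightarrow> 'v set \<Rightarrow> ('k, 'v) module" where
  "subspace_module scale W =
     \<lparr>carrier = W, monoid.mult = undefined, one = undefined,
      ring.zero = 0, ring.add = (+), module.smult = scale\<rparr>"

text \<open>The scalar multiple of the coset \<open>N + x\<close> by \<open>a\<close> is \<open>N + a x\<close>; adding \<open>N\<close> to the image of
  the coset matters only for \<open>a = 0\<close>.\<close>

definition FactModule :: "('a, 'b, 'm) module_scheme \<Rightarrow> 'b set \<Rightarrow> ('a, 'b set) module" where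
  "FactModule M N =
     \<lparr>carrier = a_rcosets\<^bsub>M\<^esub> N, monoid.mult = undefined, one = undefined,
      ring.zero = N, ring.add = set_add M,
      module.smult = (\<lambda>a A. N <+>\<^bsub>M\<^esub> (\<lambda>x. a \<odot>\<^bsub>M\<^esub> x) ` A)\<rparr>"

definition module_span :: "('a, 'r) ring_scheme \<Rightarrow> ('a, 'b, 'm) module_scheme \<Rightarrow> 'b set \<Rightarrow> 'b set" where
  "module_span R M S = \<Inter> {N. submodule N R M \<and> S \<subseteq> N}"

text \<open>Linear independence is expressed as in \<open>vector_space.dependent_def\<close>; the notion is meant for
  vector spaces, i.e. when \<open>R\<close> is a field.\<close>

definition vs_basis :: "('a, 'r) ring_scheme \<Rightarrow> ('a, 'b, 'm) module_scheme \<Rightarrow> 'b set \<Rightarrow> bool" where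
  "vs_basis R M B \<longleftrightarrow> B \<subseteq> carrier M \<and> module_span R M B = carrier M \<and>
     (\<forall>x\<in>B. x \<notin> module_span R M (B - {x}))"

text \<open>Dimensions are cardinals, represented as in the library by cardinal orders, to be compared
  by \<open>=o\<close> (the \<open>nat\<close>-valued \<open>dim\<close> of the library identifies all infinite dimensions with 0).\<close>

definition vs_dim :: "('a, 'r) ring_scheme \<Rightarrow> ('a, 'b, 'm) module_scheme \<Rightarrow> 'b rel" where
  "vs_dim R M = |SOME B. vs_basis R M B|"

definition quotient_dim ::
  "('k::field \<Rightarrow> 'v::ab_group_add \<Rightarrow> 'v) \<Rightarrow> 'v set \<Rightarrow> 'v set \<Rightarrow> 'v set rel" where
  "quotient_dim scale W U =
     vs_dim (ring_of_type_algebra :: 'k ring) (FactModule (subspace_module scale W) U)"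

end

theory Submission
  imports Defs
begin

text \<open>Fix an idempotent linear map \<open>p\<close> with kernel \<open>U\<close>. It identifies \<open>W/U\<close> with \<open>p W\<close> for every
  subspace \<open>W\<close> containing \<open>U\<close>, so \<open>dim (W/U)\<close> is the cardinality of any basis of \<open>p W\<close>. For \<open>\<L>\<close> and
  \<open>\<R>\<close> the factors are built from one-sided linear inverses, adjusted on \<open>U\<close> by means of \<open>p\<close>. If
  \<open>\<alpha> = \<lambda>\<beta>\<mu>\<close>, then \<open>\<mu>\<close> induces a linear map from \<open>V\<beta>/U\<close> onto a space containing \<open>V\<alpha>/U\<close>, so
  \<open>dim (V\<alpha>/U) \<le> dim (V\<beta>/U)\<close>; hence \<open>\<J>\<close> forces equal dimensions by the Schroeder--Bernstein theorem.
  Conversely, an isomorphism between \<open>V\<beta>/U\<close> and \<open>V\<alpha>/U\<close> lifts to one between \<open>V\<beta>\<close> and \<open>V\<alpha>\<close> that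
  fixes \<open>U\<close> pointwise, and composing \<open>\<beta>\<close> with it yields the element that relates \<open>\<alpha>\<close> and \<open>\<beta>\<close>
  under \<open>\<D>\<close>.\<close>

section \<open>Bijections of a set and Green's relations of an abstract monoid\<close>

lemma bij_betw_cancel_right:
  assumes "bij_betw f A A" "bij_betw (\<lambda>x. g (f x)) A A"
  shows "bij_betw g A A"
proof -
  have "bij_betw (g \<circ> f) A A"
    using assms(2) by (simp add: comp_def)
  then show ?thesis
    using assms(1) bij_betw_comp_iff by blast
qed

lemma (in monoid) green_R_iff:
  "(a, b) \<in> green_R G \<longleftrightarrow> a \<in> carrier G \<and> b \<in> carrier G \<and>
     (\<exists>u\<in>carrier G. \<exists>v\<in>carrier G. a \<otimes> u = b \<and> b \<otimes> v = a)"
proof -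
  have sub: "x <#\<^bsub>G\<^esub> carrier G \<subseteq> y <#\<^bsub>G\<^esub> carrier G"
    if "w \<in> carrier G" "x = y \<otimes> w" "y \<in> carrier G" for w x y
    using that by (auto simp: l_coset_def m_assoc)
  have mem: "\<exists>w\<in>carrier G. y \<otimes> w = x"
    if "x <#\<^bsub>G\<^esub> carrier G \<subseteq> y <#\<^bsub>G\<^esub> carrier G" "x \<in> carrier G" for x y
  proof -
    have "x \<in> x <#\<^bsub>G\<^esub> carrier G"
      unfolding l_coset_def using that(2) by (auto intro: bexI[of _ \<one>])
    then show ?thesis
      using that(1) by (auto simp: l_coset_def)
  qed
  show ?thesis
    unfolding green_R_def using sub mem by simp (metis order_refl subset_antisym)
qed

lemma (in monoid) green_J_dest:
  assumes "(a, b) \<in> green_J G"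
  shows "\<exists>u\<in>carrier G. \<exists>v\<in>carrier G. a = u \<otimes> (b \<otimes> v)"
proof -
  have a: "a \<in> carrier G"
    and eq: "carrier G <#> (a <#\<^bsub>G\<^esub> carrier G) = carrier G <#> (b <#\<^bsub>G\<^esub> carrier G)"
    using assms by (auto simp: green_J_def)
  have "a = \<one> \<otimes> (a \<otimes> \<one>)"
    using a by simp
  then have "a \<in> carrier G <#> (a <#\<^bsub>G\<^esub> carrier G)"
    using a unfolding set_mult_def l_coset_def by blast
  then show ?thesis
    unfolding eq by (auto simp: set_mult_def l_coset_def)
qed

lemma (in monoid) green_J_sym: "(a, b) \<in> green_J G \<Longrightarrow> (b, a) \<in> green_J G"
  by (auto simp: green_J_def)

text \<open>Multiplying \<open>Sa = Sc\<close> by \<open>S\<close> on the right and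
  \<open>cS = bS\<close> by \<open>S\<close> on the left gives
  \<open>SaS = ScS = SbS\<close>.\<close>

lemma (in monoid) green_D_subset_green_J: "green_D G \<subseteq> green_J G"
proof -
  have assoc: "carrier G <#> (x <#\<^bsub>G\<^esub> carrier G) = (carrier G #> x) <#> carrier G"
    if "x \<in> carrier G" for x
    using that by (simp add: set_mult_def l_coset_def r_coset_def m_assoc)
  have "(a, b) \<in> green_J G" if "(a, c) \<in> green_L G" "(c, b) \<in> green_R G" for a b c
    using that assoc[of a] assoc[of c] by (simp add: green_L_def green_R_def green_J_def)
  then show ?thesis
    unfolding green_D_def by blast
qed

section \<open>Linear algebra: complements, bases and their cardinalities\<close>

context vector_space
begin

text \<open>A left inverse \<open>q\<close> of the identity on \<open>U\<close> projects onto
  \<open>U\<close>, so \<open>p\<close> can be taken as the complementary projection. Its range is a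
  copy of \<open>V/U\<close> inside \<open>V\<close>.\<close>

lemma exists_idempotent_kernel:
  assumes "subspace U"
  obtains p where "Vector_Spaces.linear scale scale p" "\<And>v. p (p v) = p v" "\<And>v. p v = 0 \<longleftrightarrow> v \<in> U"
proof -
  interpret vector_space_pair scale scale by unfold_locales
  obtain q where q: "range q \<subseteq> U" "Vector_Spaces.linear scale scale q" "\<And>v. v \<in> U \<Longrightarrow> q v = v"
    using linear_exists_left_inverse_on[OF linear_id assms inj_on_id] by (auto simp: id_def)
  interpret q: Vector_Spaces.linear scale scale q by fact
  show thesis
  proof
    show "Vector_Spaces.linear scale scale (\<lambda>v. v - q v)"
      by (intro linear_compose_sub linear_ident q(2))
    show "(v - q v) - q (v - q v) = v - q v" for v
      using q(1,3) by (simp add: q.diff image_subset_iff)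
    show "v - q v = 0 \<longleftrightarrow> v \<in> U" for v
    proof
      assume "v - q v = 0"
      moreover have "q v \<in> U" using q(1) by blast
      ultimately show "v \<in> U" by (metis eq_iff_diff_eq_0)
    qed (simp add: q(3))
  qed
qed

text \<open>Extend \<open>B\<close> to a basis \<open>C\<close> of \<open>span T\<close> and thin
  \<open>T\<close> to a basis \<open>D\<close> of the same space. Any two bases are equinumerous,
  infinite ones included, so \<open>B\<close> injects into \<open>T\<close>.\<close>

lemma independent_card_le_span:
  assumes "independent B" "B \<subseteq> span T"
  shows "|B| \<le>o |T|"
proof -
  obtain C where C: "B \<subseteq> C" "C \<subseteq> span T" "independent C" "span T \<subseteq> span C"
    using maximal_independent_subset_extend[OF assms(2,1)] .
  obtain D where D: "D \<subseteq> T" "independent D" "T \<subseteq> span D"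
    using maximal_independent_subset .
  have "span C = span D"
    using C D by (metis span_mono span_minimal subset_antisym subspace_span)
  then obtain f where "bij_betw f C D"
    using bij_if_span_eq_span_bases C(3) D(2) by blast
  then have "inj_on f B" "f ` B \<subseteq> T"
    using C(1) D(1) by (auto simp: bij_betw_def intro: inj_on_subset)
  then show ?thesis
    using card_of_ordLeq by blast
qed

lemma span_eq_basis_card:
  assumes "independent B" "independent C" "span B = span C"
  shows "|B| =o |C|"
  using bij_if_span_eq_span_bases[OF assms] card_of_ordIso by blast

lemma exists_basis:
  assumes "subspace W"
  obtains B where "independent B" "span B = W"
  using assms by (metis maximal_independent_subset span_minimal subset_antisym)

text \<open>A bijection of the bases extends linearly; it is injective on \<open>span B\<close>
  because the images of the basis vectors are independent.\<close>

lemma bases_linear_bij: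
  assumes "independent B" "independent C" "|B| =o |C|"
  obtains g where "Vector_Spaces.linear scale scale g" "inj_on g (span B)" "g ` span B = span C"
proof -
  interpret vector_space_pair scale scale by unfold_locales
  obtain f where f: "bij_betw f B C"
    using assms(3) card_of_ordIso by blast
  define g where "g = construct B f"
  interpret g: Vector_Spaces.linear scale scale g
    unfolding g_def by (rule linear_construct[OF assms(1)])
  have gf: "g b = f b" if "b \<in> B" for b
    unfolding g_def by (rule construct_basis[OF assms(1) that])
  have gB: "g ` B = C"
    using f gf by (auto simp: bij_betw_def)
  have "inj_on g B"
    using f gf by (metis bij_betw_def inj_on_cong)
  then have "inj_on g (span B)"
    using g.linear_axioms assms(2) gB linear_inj_on_span_iff_independent_image by metis
  moreover have "g ` span B = span C"
    using gB g.span_image by metis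
  ultimately show thesis
    using that g.linear_axioms by blast
qed


section \<open>Dimensions of quotients\<close>

context
  fixes p :: "'b \<Rightarrow> 'b" and U W :: "'b set"
  assumes p: "Vector_Spaces.linear scale scale p" and ker: "\<And>v. p v = 0 \<longleftrightarrow> v \<in> U"
    and W: "subspace W" and UW: "U \<subseteq> W"
begin

interpretation p: Vector_Spaces.linear scale scale p by (rule p)

lemma p_eq_iff: "p v = p w \<longleftrightarrow> v - w \<in> U"
  using ker[of "v - w"] by (simp add: p.diff)

text \<open>As \<open>p\<close> has kernel \<open>U\<close>, the coset of \<open>x\<close> is the
  fibre of \<open>p\<close> through \<open>x\<close>. So sending a point to its fibre maps
  \<open>p W\<close> onto \<open>W/U\<close>; the next lemmas transport the operations along this
  map.\<close>

lemma carrier_fact: "carrier (FactModule (subspace_module scale W) U) = (\<lambda>y. p -` {y}) ` p ` W"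
proof -
  have "(\<Union>h\<in>U. {h + x}) = p -` {p x}" for x
  proof safe
    fix y assume "p y = p x"
    then have "y - x \<in> U" by (simp add: p_eq_iff)
    then show "y \<in> (\<Union>h\<in>U. {h + x})" by (intro UN_I[of "y - x"]) auto
  qed (simp add: p_eq_iff)
  then show ?thesis
    by (auto simp: FactModule_def subspace_module_def A_RCOSETS_defs r_coset_def)
qed

lemma add_fact:
  assumes "y \<in> range p" "z \<in> range p"
  shows "p -` {y} \<oplus>\<^bsub>FactModule (subspace_module scale W) U\<^esub> p -` {z} = p -` {y + z}"
proof -
  obtain v where v: "y = p v" using assms(1) by auto
  \<comment> \<open>With \<open>v\<close> over \<open>y\<close>, split \<open>x\<close> as
    \<open>v + (x - v)\<close>; the second summand lies over \<open>z\<close>.\<close>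
  have "\<exists>a\<in>p -` {y}. \<exists>b\<in>p -` {z}. x = a + b" if "p x = y + z" for x
    using that v by (intro bexI[of _ v] bexI[of _ "x - v"]) (auto simp: p.diff)
  then show ?thesis
    by (auto simp: FactModule_def subspace_module_def set_add_defs p.add)
qed

lemma zero_fact: "\<zero>\<^bsub>FactModule (subspace_module scale W) U\<^esub> = p -` {0}"
  by (auto simp: FactModule_def ker)

text \<open>For \<open>c = 0\<close> scaling collapses a nonempty fibre to 0, and the added
  \<open>U\<close> restores the fibre over 0. An empty fibre would stay empty, hence the restriction
  to \<open>range p\<close>.\<close>

lemma smult_fact:
  assumes "y \<in> range p"
  shows "c \<odot>\<^bsub>FactModule (subspace_module scale W) U\<^esub> p -` {y} = p -` {scale c y}"
proof -
  obtain v where v: "y = p v" using assms(1) by auto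
  have "\<exists>a\<in>U. \<exists>b\<in>p -` {y}. x = a + scale c b" if "p x = scale c y" for x
    using that v by (intro bexI[of _ "x - scale c v"] bexI[of _ v])
      (auto simp: p.diff p.scale simp flip: ker)
  then show ?thesis
    by (auto simp: FactModule_def subspace_module_def set_add_defs p.add p.scale)
      (auto simp flip: ker)
qed

text \<open>Points outside the range all share the empty fibre.\<close>

lemma fibre_inj: "inj_on (\<lambda>y. p -` {y}) (range p)"
  by (auto simp: inj_on_def)

text \<open>One half of the correspondence between subspaces of \<open>p W\<close> and submodules of
  \<open>W/U\<close>.\<close>

lemma submodule_fact:
  assumes Y: "subspace Y" "Y \<subseteq> p ` W"
  shows "submodule ((\<lambda>y. p -` {y}) ` Y) (ring_of_type_algebra :: 'a ring)
    (FactModule (subspace_module scale W) U)" (is "submodule ?Y _ ?M")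
proof -
  have Xr: "y \<in> range p" if "y \<in> Y" for y using that Y(2) by auto
  have pW: "subspace (p ` W)" using W by (rule p.subspace_image)
  \<comment> \<open>The inverse is a definite description, so uniqueness has to be shown as well: a
    competitor is the fibre over some \<open>z\<close>, and \<open>fibre_inj\<close> forces
    \<open>y + z = 0\<close>.\<close>
  have "inv\<^bsub>add_monoid ?M\<^esub> (p -` {y}) = p -` {- y}" if y: "y \<in> Y" for y
    unfolding m_inv_def
  proof (rule the_equality)
    have *: "y \<in> range p" "- y \<in> range p" "- y \<in> p ` W"
      using y Y Xr subspace_neg by blast+
    then show "p -` {- y} \<in> carrier (add_monoid ?M) \<and>
        p -` {y} \<otimes>\<^bsub>add_monoid ?M\<^esub> p -` {- y} = \<one>\<^bsub>add_monoid ?M\<^esub> \<and>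
        p -` {- y} \<otimes>\<^bsub>add_monoid ?M\<^esub> p -` {y} = \<one>\<^bsub>add_monoid ?M\<^esub>"
      by (auto simp: carrier_fact add_fact zero_fact)
    fix A
    assume A: "A \<in> carrier (add_monoid ?M) \<and>
        p -` {y} \<otimes>\<^bsub>add_monoid ?M\<^esub> A = \<one>\<^bsub>add_monoid ?M\<^esub> \<and>
        A \<otimes>\<^bsub>add_monoid ?M\<^esub> p -` {y} = \<one>\<^bsub>add_monoid ?M\<^esub>"
    then obtain z where z: "z \<in> p ` W" "A = p -` {z}"
      by (auto simp: carrier_fact)
    then have "p -` {y + z} = p -` {0}"
      using A * by (simp add: add_fact zero_fact image_iff) (metis add_fact rangeI)
    moreover have "y + z \<in> range p" "0 \<in> range p"
      using z(1) y Y(2) pW subspace_add subspace_0 by blast+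
    ultimately have "y + z = 0"
      using fibre_inj by (auto dest: inj_onD)
    then show "A = p -` {- y}"
      using z(2) by (simp add: add_eq_0_iff)
  qed
  then show ?thesis
    using Y Xr
    by (intro submodule.intro subgroup.intro submodule_axioms.intro)
      (auto simp: carrier_fact add_fact zero_fact smult_fact
        intro: subspace_add subspace_0 subspace_neg subspace_scale)
qed

lemma subspace_of_submodule_fact:
  assumes N: "submodule N (ring_of_type_algebra :: 'a ring)
    (FactModule (subspace_module scale W) U)"
  shows "subspace {y \<in> p ` W. p -` {y} \<in> N}"
proof -
  interpret N: submodule N "ring_of_type_algebra :: 'a ring"
    "FactModule (subspace_module scale W) U" by fact
  have pW: "subspace (p ` W)" using W by (rule p.subspace_image)
  show ?thesis
  proof (rule subspaceI)
    show "0 \<in> {y \<in> p ` W. p -` {y} \<in> N}"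
      using N.one_closed subspace_0[OF pW] by (simp add: zero_fact)
    show "x + y \<in> {y \<in> p ` W. p -` {y} \<in> N}"
      if "x \<in> {y \<in> p ` W. p -` {y} \<in> N}" "y \<in> {y \<in> p ` W. p -` {y} \<in> N}" for x y
      using that N.m_closed[of "p -` {x}" "p -` {y}"] subspace_add[OF pW, of x y] add_fact[of x y]
      by auto
    show "scale c x \<in> {y \<in> p ` W. p -` {y} \<in> N}"
      if "x \<in> {y \<in> p ` W. p -` {y} \<in> N}" for c x
    proof -
      have "c \<odot>\<^bsub>FactModule (subspace_module scale W) U\<^esub> p -` {x} \<in> N"
        using that by (intro N.smult_closed) (auto simp: ring_of_type_algebra_def)
      then have "p -` {scale c x} \<in> N"
        using that smult_fact[of x c] by auto
      then show ?thesis
        using that subspace_scale[OF pW] by blast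
    qed
  qed
qed

text \<open>The fibres over \<open>span S\<close> form a submodule; conversely, any submodule
  containing the fibres over \<open>S\<close> pulls back to a subspace containing \<open>S\<close>,
  hence \<open>span S\<close>.\<close>

lemma module_span_fact:
  assumes S: "S \<subseteq> p ` W"
  shows "module_span (ring_of_type_algebra :: 'a ring) (FactModule (subspace_module scale W) U)
    ((\<lambda>y. p -` {y}) ` S) = (\<lambda>y. p -` {y}) ` span S" (is "?L = ?R")
proof
  have "span S \<subseteq> p ` W"
    using S W by (intro span_minimal p.subspace_image)
  then show "?L \<subseteq> ?R"
    unfolding module_span_def by (intro Inter_lower) (auto intro: submodule_fact span_base)
  show "?R \<subseteq> ?L"
    unfolding module_span_def
  proof (safe intro!: InterI)
    fix y N assume y: "y \<in> span S" and N: "(\<lambda>y. p -` {y}) ` S \<subseteq> N"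
      and sub: "submodule N (ring_of_type_algebra :: 'a ring)
        (FactModule (subspace_module scale W) U)"
    have "span S \<subseteq> {y \<in> p ` W. p -` {y} \<in> N}"
      using S N by (intro span_minimal subspace_of_submodule_fact[OF sub]) auto
    then show "p -` {y} \<in> N" using y by auto
  qed
qed

text \<open>Since fibres are injective on \<open>p W\<close>, deleting a point commutes with passing
  to fibres, so independence and spanning transfer both ways.\<close>

lemma vs_basis_fact_iff:
  assumes S: "S \<subseteq> p ` W"
  shows "vs_basis (ring_of_type_algebra :: 'a ring) (FactModule (subspace_module scale W) U)
    ((\<lambda>y. p -` {y}) ` S) \<longleftrightarrow> independent S \<and> span S = p ` W"
proof -
  let ?F = "\<lambda>y. p -` {y}"
  have inj: "inj_on ?F (p ` W)"
    by (rule inj_on_subset[OF fibre_inj]) auto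
  have sub: "span T \<subseteq> p ` W" if "T \<subseteq> S" for T
    using that S W by (intro span_minimal p.subspace_image) auto
  have indep: "?F x \<notin> module_span (ring_of_type_algebra :: 'a ring)
      (FactModule (subspace_module scale W) U) (?F ` S - {?F x}) \<longleftrightarrow> x \<notin> span (S - {x})"
    if x: "x \<in> S" for x
  proof -
    have "?F ` (S - {x}) = ?F ` S - ?F ` {x}"
      using x S by (intro inj_on_image_set_diff[OF inj]) auto
    then have "?F ` S - {?F x} = ?F ` (S - {x})"
      by simp
    moreover have "?F x \<in> ?F ` span (S - {x}) \<longleftrightarrow> x \<in> span (S - {x})"
      using x S by (intro inj_on_image_mem_iff[OF inj] sub) auto
    moreover have "S - {x} \<subseteq> p ` W"
      using S by auto
    ultimately show ?thesis
      by (metis module_span_fact)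
  qed
  have "(\<forall>A\<in>?F ` S. A \<notin> module_span (ring_of_type_algebra :: 'a ring)
      (FactModule (subspace_module scale W) U) (?F ` S - {A})) \<longleftrightarrow> (\<forall>x\<in>S. x \<notin> span (S - {x}))"
    unfolding ball_simps(9) by (intro ball_cong refl indep)
  moreover have "?F ` span S = ?F ` p ` W \<longleftrightarrow> span S = p ` W"
    by (rule inj_on_image_eq_iff[OF inj sub[OF order_refl] order_refl])
  moreover have "?F ` S \<subseteq> ?F ` p ` W"
    using S by (rule image_mono)
  ultimately show ?thesis
    unfolding vs_basis_def dependent_def carrier_fact module_span_fact[OF S] by metis
qed

text \<open>The fibres over \<open>C\<close> witness that a basis exists, so the one picked by
  \<open>SOME\<close> is genuine. It consists of the fibres over a basis \<open>S\<close> of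
  \<open>p W\<close>, which is equinumerous with \<open>C\<close>.\<close>

lemma quotient_dim_eq_card:
  assumes C: "independent C" "span C = p ` W"
  shows "quotient_dim scale W U =o |C|"
proof -
  let ?F = "\<lambda>y. p -` {y}"
  let ?basis = "vs_basis (ring_of_type_algebra :: 'a ring) (FactModule (subspace_module scale W) U)"
  have "?basis (?F ` C)"
    using C span_superset[of C] by (subst vs_basis_fact_iff) auto
  then have B: "?basis (SOME B. ?basis B)"
    by (rule someI)
  then obtain S where S: "S \<subseteq> p ` W" "(SOME B. ?basis B) = ?F ` S"
    by (auto simp: vs_basis_def carrier_fact subset_image_iff)
  have "inj_on ?F S"
    using S(1) by (intro inj_on_subset[OF fibre_inj]) auto
  then have "|?F ` S| =o |S|"
    by (meson card_of_ordIsoI inj_on_imp_bij_betw ordIso_symmetric)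
  moreover have "|S| =o |C|"
    using B C S vs_basis_fact_iff[OF S(1)] by (intro span_eq_basis_card) auto
  ultimately show ?thesis
    unfolding quotient_dim_def vs_dim_def S(2) by (rule ordIso_transitive)
qed

end


section \<open>Green's relations of the monoid of linear maps bijective on a subspace\<close>

lemma linear_L_GL: "a \<in> carrier (L_GL scale U) \<Longrightarrow> Vector_Spaces.linear scale scale a"
  and bij_L_GL: "a \<in> carrier (L_GL scale U) \<Longrightarrow> bij_betw a U U"
  by (auto simp: L_GL_def)

lemma mult_L_GL: "a \<otimes>\<^bsub>L_GL scale U\<^esub> b = b \<circ> a"
  by (simp add: L_GL_def)

lemma subset_range_L_GL: "a \<in> carrier (L_GL scale U) \<Longrightarrow> U \<subseteq> range a"
  using bij_L_GL by (metis bij_betw_imp_surj_on image_mono top_greatest)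

lemma subspace_range_L_GL:
  assumes "a \<in> carrier (L_GL scale U)"
  shows "subspace (range a)"
proof -
  interpret a: Vector_Spaces.linear scale scale a using assms by (rule linear_L_GL)
  show ?thesis by (rule a.subspace_image[OF subspace_UNIV])
qed

lemma mem_L_GL_cancel_right:
  assumes "a \<in> carrier (L_GL scale U)" "Vector_Spaces.linear scale scale d"
    and "(\<lambda>x. d (a x)) \<in> carrier (L_GL scale U)"
  shows "d \<in> carrier (L_GL scale U)"
  using assms bij_betw_cancel_right[of a U d] by (auto simp: L_GL_def)

text \<open>\<open>a\<close> is lifted through a linear section \<open>k\<close> of \<open>b\<close>
  over \<open>range b\<close> that restricts to the inverse of \<open>b\<close> on
  \<open>U\<close>.\<close>

lemma factor_left:
  assumes U: "subspace U" and a: "a \<in> carrier (L_GL scale U)" and b: "b \<in> carrier (L_GL scale U)"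
    and range: "range a \<subseteq> range b"
  obtains c where "c \<in> carrier (L_GL scale U)" "c \<otimes>\<^bsub>L_GL scale U\<^esub> b = a"
proof -
  interpret vector_space_pair scale scale by unfold_locales
  interpret a: Vector_Spaces.linear scale scale a using a by (rule linear_L_GL)
  interpret b: Vector_Spaces.linear scale scale b using b by (rule linear_L_GL)
  obtain p where p: "Vector_Spaces.linear scale scale p" "\<And>v. p (p v) = p v" "\<And>v. p v = 0 \<longleftrightarrow> v \<in> U"
    using exists_idempotent_kernel[OF U] by blast
  interpret p: Vector_Spaces.linear scale scale p by fact
  have inj: "inj_on b U" and bU: "b ` U = U" and aU: "bij_betw a U U"
    using bij_L_GL[OF b] bij_L_GL[OF a] by (auto simp: bij_betw_def)
  obtain g where g: "range g \<subseteq> U" "Vector_Spaces.linear scale scale g" "\<And>v. v \<in> U \<Longrightarrow> g (b v) = v"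
    using linear_exists_left_inverse_on[OF b.linear_axioms U inj] by auto
  obtain h where h: "Vector_Spaces.linear scale scale h" "\<And>v. b (h (b v)) = b v"
    using linear_exists_right_inverse_on[OF b.linear_axioms subspace_UNIV] by auto
  interpret g: Vector_Spaces.linear scale scale g by fact
  interpret h: Vector_Spaces.linear scale scale h by fact
  have bg: "b (g u) = u" if "u \<in> U" for u
    using that bU g(3) by (metis imageE)
  \<comment> \<open>The section \<open>h\<close> need not preserve \<open>U\<close>. So the
    \<open>U\<close>-component \<open>v - p v\<close> is sent through \<open>g\<close>, the inverse
    of \<open>b\<close> on \<open>U\<close>, and only \<open>p v\<close> through
    \<open>h\<close>.\<close>
  define k where "k v = g (v - p v) + h (p v)" for v
  have k: "Vector_Spaces.linear scale scale k"
    unfolding k_def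
    by unfold_locales (auto simp: p.add p.scale g.add g.scale g.diff h.add h.scale algebra_simps)
  have bk: "b (k v) = v" if "v \<in> range b" for v
  proof -
    have u: "v - p v \<in> U"
      by (simp add: p(2) p.diff flip: p(3))
    then have "v - p v \<in> range b"
      using subset_range_L_GL[OF b] by auto
    \<comment> \<open>\<open>h\<close> is a section only over \<open>range b\<close>, so
      \<open>p v\<close> must be placed there.\<close>
    then have "p v \<in> range b"
      using that subspace_diff[OF subspace_range_L_GL[OF b], of v "v - p v"] by simp
    then have "b (h (p v)) = p v"
      using h(2) by auto
    then show ?thesis
      using bg[OF u] by (simp add: k_def b.add)
  qed
  have kU: "k u = g u" if "u \<in> U" for u
    using that by (simp add: k_def p(3)[THEN iffD2] h.zero)
  have b_closed: "b u \<in> U" if "u \<in> U" for u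
    using that bU by blast
  have "bij_betw k U U"
    by (rule bij_betw_byWitness[where f' = b])
      (use kU bg g(1,3) b_closed in \<open>auto simp: image_subset_iff\<close>)
  then have "k \<circ> a \<in> carrier (L_GL scale U)"
    using aU k a.linear_axioms
    by (auto simp: L_GL_def intro: bij_betw_trans Vector_Spaces.linear_compose)
  moreover have "b (k (a v)) = a v" for v
    using bk range by blast
  then have "(k \<circ> a) \<otimes>\<^bsub>L_GL scale U\<^esub> b = a"
    by (simp add: mult_L_GL fun_eq_iff)
  ultimately show thesis by (rule that)
qed

text \<open>The kernel inclusion makes \<open>a\<close> constant on the fibres of \<open>b\<close>,
  so \<open>a\<close> is recovered from \<open>b v\<close> by applying \<open>a\<close> to any
  linear choice \<open>h\<close> of preimages.\<close>

lemma factor_right: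
  assumes a: "a \<in> carrier (L_GL scale U)" and b: "b \<in> carrier (L_GL scale U)"
    and ker: "{v. b v = 0} \<subseteq> {v. a v = 0}"
  obtains c where "c \<in> carrier (L_GL scale U)" "b \<otimes>\<^bsub>L_GL scale U\<^esub> c = a"
proof -
  interpret vector_space_pair scale scale by unfold_locales
  interpret a: Vector_Spaces.linear scale scale a using a by (rule linear_L_GL)
  interpret b: Vector_Spaces.linear scale scale b using b by (rule linear_L_GL)
  obtain h where h: "Vector_Spaces.linear scale scale h" "\<And>v. b (h (b v)) = b v"
    using linear_exists_right_inverse_on[OF b.linear_axioms subspace_UNIV] by auto
  have ahb: "a (h (b v)) = a v" for v
  proof -
    have "b (h (b v) - v) = 0" by (simp add: b.diff h(2))
    then have "a (h (b v) - v) = 0" using ker by blast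
    then show ?thesis by (simp add: a.diff)
  qed
  have "a \<circ> h \<in> carrier (L_GL scale U)"
  \<comment> \<open>Applied after \<open>b\<close>, this map gives \<open>a\<close>; as
    \<open>a\<close> and \<open>b\<close> permute \<open>U\<close>, so does it.\<close>
  proof (rule mem_L_GL_cancel_right[OF b])
    show "Vector_Spaces.linear scale scale (a \<circ> h)"
      using h(1) a.linear_axioms by (rule Vector_Spaces.linear_compose)
  qed (use a ahb in simp)
  moreover have "b \<otimes>\<^bsub>L_GL scale U\<^esub> (a \<circ> h) = a"
    using ahb by (auto simp: mult_L_GL)
  ultimately show thesis by (rule that)
qed

text \<open>Left multiplication is precomposition, which can only shrink the range;
  \<open>factor_left\<close> is the converse.\<close>

lemma green_L_L_GL_iff:
  assumes U: "subspace U" and a: "a \<in> carrier (L_GL scale U)" and b: "b \<in> carrier (L_GL scale U)"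
  shows "(a, b) \<in> green_L (L_GL scale U) \<longleftrightarrow> range a = range b"
proof -
  interpret S: monoid "L_GL scale U" by (rule monoid_L_GL) (rule vector_space_axioms)
  show ?thesis
  proof
    assume "(a, b) \<in> green_L (L_GL scale U)"
    then obtain u v where "b = a \<circ> u" "a = b \<circ> v"
      unfolding S.green_L_iff by (metis mult_L_GL)
    then show "range a = range b"
      by (metis image_comp image_mono subset_antisym top_greatest)
  next
    assume "range a = range b"
    then show "(a, b) \<in> green_L (L_GL scale U)"
      unfolding S.green_L_iff using a b factor_left[OF U a b] factor_left[OF U b a]
      by (metis order_refl)
  qed
qed

text \<open>Right multiplication is postcomposition, which can only enlarge the kernel;
  \<open>factor_right\<close> is the converse.\<close>

lemma green_R_L_GL_iff:
  assumes a: "a \<in> carrier (L_GL scale U)" and b: "b \<in> carrier (L_GL scale U)"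
  shows "(a, b) \<in> green_R (L_GL scale U) \<longleftrightarrow> {v. a v = 0} = {v. b v = 0}"
proof -
  interpret S: monoid "L_GL scale U" by (rule monoid_L_GL) (rule vector_space_axioms)
  have zero: "u 0 = 0" if "u \<in> carrier (L_GL scale U)" for u
    using linear_L_GL[OF that] by (metis Vector_Spaces.linear.axioms(3) module_hom.zero)
  show ?thesis
  proof
    assume "(a, b) \<in> green_R (L_GL scale U)"
    then obtain u v where "u \<in> carrier (L_GL scale U)" "v \<in> carrier (L_GL scale U)"
      "b = u \<circ> a" "a = v \<circ> b"
      unfolding S.green_R_iff by (metis mult_L_GL)
    then show "{v. a v = 0} = {v. b v = 0}"
      using zero by (metis comp_apply)
  next
    assume "{v. a v = 0} = {v. b v = 0}"
    then show "(a, b) \<in> green_R (L_GL scale U)"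
      unfolding S.green_R_iff using a b factor_right[OF a b] factor_right[OF b a]
      by (metis order_refl)
  qed
qed

section \<open>Quotient dimension and the relations J and D\<close>

lemma quotient_dim_mono_green_J:
  assumes U: "subspace U" and J: "(a, b) \<in> green_J (L_GL scale U)"
  shows "quotient_dim scale (range a) U \<le>o quotient_dim scale (range b) U"
proof -
  interpret S: monoid "L_GL scale U" by (rule monoid_L_GL) (rule vector_space_axioms)
  obtain u v where u: "u \<in> carrier (L_GL scale U)" and v: "v \<in> carrier (L_GL scale U)"
    and "a = u \<otimes>\<^bsub>L_GL scale U\<^esub> (b \<otimes>\<^bsub>L_GL scale U\<^esub> v)"
    using S.green_J_dest[OF J] by metis
  then have eq: "a = v \<circ> b \<circ> u"
    by (simp only: mult_L_GL)
  have a: "a \<in> carrier (L_GL scale U)" and b: "b \<in> carrier (L_GL scale U)"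
    using J by (auto simp: green_J_def)
  obtain p where p: "Vector_Spaces.linear scale scale p" "\<And>v. p (p v) = p v" "\<And>v. p v = 0 \<longleftrightarrow> v \<in> U"
    using exists_idempotent_kernel[OF U] by blast
  interpret p: Vector_Spaces.linear scale scale p by fact
  interpret v: Vector_Spaces.linear scale scale v using v by (rule linear_L_GL)
  obtain B where B: "independent B" "span B = p ` range a"
    using exists_basis[OF p.subspace_image[OF subspace_range_L_GL[OF a]]] .
  obtain C where C: "independent C" "span C = p ` range b"
    using exists_basis[OF p.subspace_image[OF subspace_range_L_GL[OF b]]] .
  \<comment> \<open>\<open>v\<close> maps \<open>U\<close> into \<open>U\<close>, so
    \<open>p (v w)\<close> depends only on \<open>w\<close> modulo \<open>U\<close>: this is the map
    induced by \<open>v\<close> on the quotient.\<close>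
  have "p (v w) = p (v (p w))" for w
  proof -
    have "p (w - p w) = 0" by (simp add: p(2) p.diff)
    then have "w - p w \<in> U" by (simp add: p(3))
    then have "v (w - p w) \<in> U" using bij_L_GL[OF v] by (auto simp: bij_betw_def)
    then have "p (v w - v (p w)) = 0" by (simp add: p(3) v.diff)
    then show ?thesis by (simp add: p.diff)
  qed
  then have "p ` range a \<subseteq> (p \<circ> v) ` p ` range b"
    unfolding eq by auto
  also have "\<dots> = span ((p \<circ> v) ` C)"
    unfolding C(2)[symmetric] image_comp[symmetric] p.span_image v.span_image ..
  finally have "B \<subseteq> span ((p \<circ> v) ` C)"
    using B(2) span_superset by blast
  then have "|B| \<le>o |C|"
    using independent_card_le_span[OF B(1)] card_of_image ordLeq_transitive by blast
  then show ?thesis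
    using quotient_dim_eq_card[OF p(1,3) subspace_range_L_GL[OF a] subset_range_L_GL[OF a] B]
      quotient_dim_eq_card[OF p(1,3) subspace_range_L_GL[OF b] subset_range_L_GL[OF b] C]
    by (meson ordIso_ordLeq_trans ordIso_symmetric ordLeq_ordIso_trans)
qed

lemma quotient_dim_eq_green_J:
  assumes "subspace U" "(a, b) \<in> green_J (L_GL scale U)"
  shows "quotient_dim scale (range a) U =o quotient_dim scale (range b) U"
proof -
  interpret S: monoid "L_GL scale U" by (rule monoid_L_GL) (rule vector_space_axioms)
  show ?thesis
    using assms by (simp add: ordIso_iff_ordLeq quotient_dim_mono_green_J S.green_J_sym)
qed

text \<open>The intermediate element is \<open>h \<circ> b\<close>: it has the range of
  \<open>a\<close>, and the kernel of \<open>b\<close> because \<open>h\<close> is injective on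
  \<open>range b\<close>.\<close>

lemma green_D_if_quotient_dim_eq:
  assumes U: "subspace U" and a: "a \<in> carrier (L_GL scale U)" and b: "b \<in> carrier (L_GL scale U)"
    and dim: "quotient_dim scale (range a) U =o quotient_dim scale (range b) U"
  shows "(a, b) \<in> green_D (L_GL scale U)"
proof -
  obtain p where p: "Vector_Spaces.linear scale scale p" "\<And>v. p (p v) = p v" "\<And>v. p v = 0 \<longleftrightarrow> v \<in> U"
    using exists_idempotent_kernel[OF U] by blast
  interpret p: Vector_Spaces.linear scale scale p by fact
  interpret b: Vector_Spaces.linear scale scale b using b by (rule linear_L_GL)
  note ra = subspace_range_L_GL[OF a] subset_range_L_GL[OF a]
  note rb = subspace_range_L_GL[OF b] subset_range_L_GL[OF b]
  obtain B where B: "independent B" "span B = p ` range a"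
    using exists_basis[OF p.subspace_image[OF ra(1)]] .
  obtain C where C: "independent C" "span C = p ` range b"
    using exists_basis[OF p.subspace_image[OF rb(1)]] .
  have "|C| =o |B|"
    using dim quotient_dim_eq_card[OF p(1,3) ra B] quotient_dim_eq_card[OF p(1,3) rb C]
    by (meson ordIso_symmetric ordIso_transitive)
  then obtain g where g: "Vector_Spaces.linear scale scale g" "inj_on g (p ` range b)"
    "g ` p ` range b = p ` range a"
    using bases_linear_bij[OF C(1) B(1)] B(2) C(2) by metis
  interpret g: Vector_Spaces.linear scale scale g by fact
  \<comment> \<open>Along the splitting of \<open>V\<close> into \<open>U\<close> and the range of
    \<open>p\<close>, this is the identity on \<open>U\<close> and \<open>g\<close> on the
    complement.\<close>
  define h where "h v = (v - p v) + g (p v)" for v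
  interpret h: Vector_Spaces.linear scale scale h
    unfolding h_def
    by unfold_locales (auto simp: p.add p.scale g.add g.scale algebra_simps)
  have diff_U: "v - p v \<in> U" for v
    by (simp add: p(2) p.diff flip: p(3))
  have ph: "p (h v) = g (p v)" if v: "v \<in> range b" for v
  proof -
    \<comment> \<open>\<open>g\<close> is controlled only on the image of \<open>range b\<close>;
      there its values are fixed by \<open>p\<close>.\<close>
    have "g (p v) \<in> p ` range a" using g(3) v by blast
    then show ?thesis using p(2) by (auto simp: h_def p.add p.diff)
  qed
  \<comment> \<open>This lets the splitting \<open>v = (v - p v) + p v\<close> be carried out inside
    either range.\<close>
  have p_closed: "p v \<in> W" if "v \<in> W" "subspace W" "U \<subseteq> W" for v W
    using that diff_U[of v] subspace_diff[of W v "v - p v"] by auto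
  have hU: "h u = u" if "u \<in> U" for u
    using that by (simp add: h_def p(3)[THEN iffD2] g.zero)
  have ker: "h v = 0 \<longleftrightarrow> v = 0" if v: "v \<in> range b" for v
  proof
    assume 0: "h v = 0"
    \<comment> \<open>Applying \<open>p\<close> isolates the \<open>g\<close>-part; once
      \<open>p v = 0\<close> is known, \<open>h v\<close> is just \<open>v\<close>.\<close>
    then have "g (p v) = g 0" using ph[OF v] by (simp add: p.zero g.zero)
    moreover have "0 \<in> p ` range b"
      using p.subspace_image[OF rb(1)] subspace_0 by blast
    ultimately have "p v = 0"
      using v inj_onD[OF g(2), of "p v" 0] by blast
    then show "v = 0" using 0 by (simp add: h_def g.zero)
  qed (simp add: h.zero)
  have range: "h ` range b = range a"
  proof (rule equalityI; rule subsetI)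
    fix w assume "w \<in> h ` range b"
    then obtain v where v: "v \<in> range b" "w = h v" by blast
    have "g (p v) \<in> p ` range a" using g(3) v(1) by blast
    then have "g (p v) \<in> range a" using p_closed[OF _ ra] by auto
    moreover have "v - p v \<in> range a" using diff_U ra(2) by blast
    ultimately show "w \<in> range a"
      unfolding v(2) h_def by (intro subspace_add[OF ra(1)])
  next
    fix w assume w: "w \<in> range a"
    then have "p w \<in> g ` p ` range b"
      by (simp add: g(3))
    then obtain v where v: "v \<in> range b" "g (p v) = p w"
      by (metis imageE)
    \<comment> \<open>A preimage of \<open>w\<close> under \<open>h\<close>: keep its
      \<open>U\<close>-part and replace \<open>p w\<close> by \<open>p v\<close>.\<close>
    have "(w - p w) + p v \<in> range b"
      using diff_U rb(2) p_closed[OF v(1) rb] by (intro subspace_add[OF rb(1)]) blast+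
    moreover have "h ((w - p w) + p v) = w"
      by (simp add: h_def p.add p.diff p(2) v(2))
    ultimately show "w \<in> h ` range b" by (metis image_eqI)
  qed
  have "bij_betw (h \<circ> b) U U"
    using bij_L_GL[OF b] hU by (intro bij_betw_trans[of b U U h U]) (auto simp: bij_betw_def inj_on_def)
  then have hb: "h \<circ> b \<in> carrier (L_GL scale U)"
    using Vector_Spaces.linear_compose[OF b.linear_axioms h.linear_axioms] by (simp add: L_GL_def)
  have "(a, h \<circ> b) \<in> green_L (L_GL scale U)"
    using range by (simp add: green_L_L_GL_iff[OF U a hb] image_comp)
  moreover have "(h \<circ> b, b) \<in> green_R (L_GL scale U)"
    using ker by (simp add: green_R_L_GL_iff[OF hb b])
  ultimately show ?thesis
    unfolding green_D_def by blast
qed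

end

theorem theorem3p5:
  fixes scale :: "'k::field \<Rightarrow> 'v::ab_group_add \<Rightarrow> 'v"
    and U :: "'v set"
  assumes "vector_space scale"
    and "module.subspace scale U"
    and "U \<noteq> UNIV"
  shows "(\<forall>\<alpha> \<in> carrier (L_GL scale U). \<forall>\<beta> \<in> carrier (L_GL scale U).
            ((\<alpha>, \<beta>) \<in> green_L (L_GL scale U) \<longleftrightarrow> range \<alpha> = range \<beta>) \<and>
            ((\<alpha>, \<beta>) \<in> green_R (L_GL scale U) \<longleftrightarrow> {v. \<alpha> v = 0} = {v. \<beta> v = 0}) \<and>
            ((\<alpha>, \<beta>) \<in> green_H (L_GL scale U) \<longleftrightarrow>
               range \<alpha> = range \<beta> \<and> {v. \<alpha> v = 0} = {v. \<beta> v = 0}) \<and>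
            ((\<alpha>, \<beta>) \<in> green_D (L_GL scale U) \<longleftrightarrow>
               quotient_dim scale (range \<alpha>) U =o quotient_dim scale (range \<beta>) U)) \<and>
         green_D (L_GL scale U) = green_J (L_GL scale U)"
proof -
  interpret vector_space scale by fact
  interpret S: monoid "L_GL scale U" by (rule monoid_L_GL) fact
  note U = \<open>module.subspace scale U\<close>
  \<comment> \<open>A cycle of implications: D lies in J, J forces equal dimensions, and equal
    dimensions give D.\<close>
  have D: "(\<alpha>, \<beta>) \<in> green_D (L_GL scale U) \<longleftrightarrow>
      quotient_dim scale (range \<alpha>) U =o quotient_dim scale (range \<beta>) U"
    if "\<alpha> \<in> carrier (L_GL scale U)" "\<beta> \<in> carrier (L_GL scale U)" for \<alpha> \<beta>
    using that S.green_D_subset_green_J quotient_dim_eq_green_J[OF U]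
      green_D_if_quotient_dim_eq[OF U] by blast
  have "green_J (L_GL scale U) \<subseteq> green_D (L_GL scale U)"
    using D quotient_dim_eq_green_J[OF U] by (auto simp: green_J_def)
  then have "green_D (L_GL scale U) = green_J (L_GL scale U)"
    using S.green_D_subset_green_J by (rule subset_antisym[rotated])
  then show ?thesis
    using D by (simp add: green_H_def green_L_L_GL_iff[OF U] green_R_L_GL_iff)
qed

end
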